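(* There exists an absolute constant $c>0$ such that the following holds. Let $n\ge 1$, let $p_1,\dots,p_n\in[0,1]$ with $\lambda=p_1+\dots+p_n>0$, put $\lambda_2=p_1^2+\dots+p_n^2$, let $W=X_1+\dots+X_n$ where $X_1,\dots,X_n$ are independent Bernoulli random variables with $\mathbb{P}\{X_j=1\}=p_j$, $\mathbb{P}\{X_j=0\}=1-p_j$, and let $Z$ be a Poisson random variable with parameter $\lambda$. If $\lambda_2\le \lambda/2$, then $$D(W\|Z)\le \chi^2(W,Z)\le c\,\Big(\frac{\lambda_2}{\lambda}\Big)^2 .$$
   Context: Write $w_k=\mathbb{P}\{W=k\}$ and $v_k=\mathbb{P}\{Z=k\}=\frac{\lambda^k}{k!}e^{-\lambda}$ for $k=0,1,2,\dots$. The relative entropy is $D(W\|Z)=\sum_{k=0}^\infty w_k\log\frac{w_k}{v_k}$ (natural logarithm, with $0\log 0=0$). The Pearson $\chi^2$-distance is $\chi^2(W,Z)=\sum_{k=0}^\infty\frac{(w_k-v_k)^2}{v_k}$. *)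

theory Defs
  imports "HOL-Probability.Probability"
begin

text \<open>
  The law of \<open>W = X\<^sub>1 + \<dots> + X\<^sub>n\<close> for independent Bernoulli variables \<open>X\<^sub>j\<close> with parameters \<open>p j\<close>.
  The event \<open>X\<^sub>j = 1\<close> is coded as \<open>x j = True\<close>. Values of \<open>p\<close> outside \<open>{1..n}\<close> are irrelevant.
  The lemma \<open>measure_bernoulli_sum\<close> below shows that this is the law of such a sum on every
  probability space. Working with the law keeps the sample space, hence its type, out of the
  statement, so that an existentially quantified constant cannot depend on it.
\<close>
definition bernoulli_sum_pmf :: "nat \<Rightarrow> (nat \<Rightarrow> real) \<Rightarrow> nat pmf" where
  "bernoulli_sum_pmf n p =
     map_pmf (\<lambda>x. \<Sum>j=1..n. of_bool (x j)) (Pi_pmf {1..n} False (\<lambda>j. bernoulli_pmf (p j)))"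

text \<open>
  Both distances are meant for reference laws \<open>Z\<close> that charge every natural number, so the
  convention for division by zero plays no role; the term with \<open>pmf W k = 0\<close> vanishes since
  the factor does. The lemmas below show that the two series converge whenever \<open>W\<close> is
  finitely supported.
\<close>
definition relative_entropy :: "nat pmf \<Rightarrow> nat pmf \<Rightarrow> real" where
  "relative_entropy W Z = (\<Sum>k. pmf W k * ln (pmf W k / pmf Z k))"

definition chi2_dist :: "nat pmf \<Rightarrow> nat pmf \<Rightarrow> real" where
  "chi2_dist W Z = (\<Sum>k. (pmf W k - pmf Z k)\<^sup>2 / pmf Z k)"

lemma set_pmf_bernoulli_sum: "set_pmf (bernoulli_sum_pmf n p) \<subseteq> {..n}"
proof -
  have "(\<Sum>j=1..n. of_bool (x j)) \<le> n" for x :: "nat \<Rightarrow> bool"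
    using sum_bounded_above[of "{1..n}" "\<lambda>j. of_bool (x j)" "1::nat"] by simp
  then show ?thesis
    by (auto simp: bernoulli_sum_pmf_def)
qed

lemma summable_relative_entropy:
  assumes "finite (set_pmf W)"
  shows "summable (\<lambda>k. pmf W k * ln (pmf W k / pmf Z k))"
  by (rule summable_finite[OF assms]) (simp add: set_pmf_iff)

lemma summable_chi2_dist:
  assumes "finite (set_pmf W)"
  shows "summable (\<lambda>k. (pmf W k - pmf Z k)\<^sup>2 / pmf Z k)"
proof -
  have Z: "summable (pmf Z)"
    using pmf_abs_summable[of Z UNIV] by (simp add: abs_summable_on_nat_iff')
  have "summable (\<lambda>k. (pmf W k - pmf Z k)\<^sup>2 / pmf Z k - pmf Z k)"
    by (rule summable_finite[OF assms]) (simp add: set_pmf_iff power2_eq_square)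
  from summable_add[OF this Z] show ?thesis
    by simp
qed

lemma measure_bernoulli_sum:
  fixes X :: "nat \<Rightarrow> 'a \<Rightarrow> nat"
  assumes M: "prob_space M" and n: "n \<ge> 1"
    and p: "\<And>j. j \<in> {1..n} \<Longrightarrow> p j \<in> {0..1}"
    and indep: "prob_space.indep_vars M (\<lambda>_. count_space UNIV) X {1..n}"
    and X1: "\<And>j. j \<in> {1..n} \<Longrightarrow> measure M {x \<in> space M. X j x = 1} = p j"
    and X0: "\<And>j. j \<in> {1..n} \<Longrightarrow> measure M {x \<in> space M. X j x = 0} = 1 - p j"
  shows "measure M {x \<in> space M. (\<Sum>j=1..n. X j x) = k} = pmf (bernoulli_sum_pmf n p) k"
proof -
  interpret prob_space M by (rule M)
  let ?C = "\<lambda>_::nat. count_space (UNIV :: nat set)"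
  let ?Q = "Pi_pmf {1..n} False (\<lambda>j. bernoulli_pmf (p j))"
  let ?Y = "\<lambda>j x. of_bool (x j) :: nat"
  let ?S = "\<lambda>x. \<Sum>j=1..n. x j :: nat"
  have rvX: "X j \<in> measurable M (count_space UNIV)" if "j \<in> {1..n}" for j
    using indep that by (auto simp: indep_vars_def)
  have S: "?S \<in> measurable (\<Pi>\<^sub>M j\<in>{1..n}. ?C j) (count_space UNIV)"
    by measurable
  have marg: "distr M (count_space UNIV) (X j) = distr ?Q (count_space UNIV) (?Y j)"
    if j: "j \<in> {1..n}" for j
  proof -
    interpret D: prob_space "distr M (count_space UNIV) (X j)"
      by (rule prob_space_distr[OF rvX[OF j]])
    have Q: "distr ?Q (count_space UNIV) (?Y j) = map_pmf of_bool (bernoulli_pmf (p j))"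
    proof -
      have "map_pmf (?Y j) ?Q = map_pmf of_bool (map_pmf (\<lambda>x. x j) ?Q)"
        by (simp add: pmf.map_comp o_def)
      also have "map_pmf (\<lambda>x. x j) ?Q = bernoulli_pmf (p j)"
        using j by (subst Pi_pmf_component) auto
      finally show ?thesis
        by (simp add: map_pmf_rep_eq[symmetric])
    qed
    have D: "measure (distr M (count_space UNIV) (X j)) {i}
        = measure (map_pmf of_bool (bernoulli_pmf (p j))) {i}"
      if "i \<in> {0, 1}" for i :: nat
    proof -
      have "measure (distr M (count_space UNIV) (X j)) {i} = measure M {x \<in> space M. X j x = i}"
        by (subst measure_distr[OF rvX[OF j]]) (auto intro!: arg_cong[where f="measure M"])
      also have "\<dots> = (if i = 1 then p j else 1 - p j)"
        using that X1[OF j] X0[OF j] by auto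
      also have "\<dots> = pmf (map_pmf of_bool (bernoulli_pmf (p j))) i"
      proof -
        have v: "of_bool -` {1::nat} = {True}" "of_bool -` {0::nat} = {False}"
          by (auto simp: of_bool_def split: if_splits)
        show ?thesis
          using that p[OF j] by (auto simp: pmf_map v[unfolded One_nat_def] measure_pmf_single)
      qed
      finally show ?thesis
        by (simp add: measure_pmf_single)
    qed
    have full: "measure (distr M (count_space UNIV) (X j)) {0, 1} = 1"
    proof -
      have "measure (distr M (count_space UNIV) (X j)) {0, 1}
          = measure (distr M (count_space UNIV) (X j)) {0}
            + measure (distr M (count_space UNIV) (X j)) {1}"
        by (subst D.finite_measure_Union[symmetric]) (auto simp: insert_commute)
      also have "\<dots> = measure M {x \<in> space M. X j x = 0} + measure M {x \<in> space M. X j x = 1}"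
        by (subst (1 2) measure_distr[OF rvX[OF j]])
           (auto intro!: arg_cong2[where f="(+)"] arg_cong[where f="measure M"])
      finally show ?thesis
        using X0[OF j] X1[OF j] by simp
    qed
    have out: "emeasure (distr M (count_space UNIV) (X j)) {i} = 0" if "i \<notin> {0, 1}" for i
    proof -
      have "measure (distr M (count_space UNIV) (X j)) ({0, 1} \<union> {i}) = 1 +
          measure (distr M (count_space UNIV) (X j)) {i}"
        using that full by (subst D.finite_measure_Union) auto
      then have "measure (distr M (count_space UNIV) (X j)) {i} \<le> 0"
        using D.prob_le_1 by (metis add_le_same_cancel1)
      then show ?thesis
        by (simp add: D.emeasure_eq_measure measure_le_0_iff)
    qed
    have outQ: "emeasure (map_pmf of_bool (bernoulli_pmf (p j))) {i} = 0" if "i \<notin> {0, 1}" for i :: nat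
      using that by (auto simp: emeasure_pmf_single pmf_eq_0_set_pmf of_bool_def split: if_splits)
    show ?thesis
      unfolding Q
    proof (rule measure_eqI_countable[of _ UNIV])
      fix i :: nat
      show "emeasure (distr M (count_space UNIV) (X j)) {i}
          = emeasure (map_pmf of_bool (bernoulli_pmf (p j))) {i}"
        using D[of i] out[of i] outQ[of i]
        by (cases "i \<in> {0, 1}") (auto simp: D.emeasure_eq_measure measure_pmf.emeasure_eq_measure)
    qed auto
  qed
  have "prob_space.indep_vars ?Q ?C (\<lambda>j x. of_bool (x j)) {1..n}"
    using prob_space.indep_vars_compose2[OF prob_space_measure_pmf indep_vars_Pi_pmf[of "{1..n}" False "\<lambda>j. bernoulli_pmf (p j)"],
      of "\<lambda>_. of_bool" ?C] by simp
  then have "distr ?Q (\<Pi>\<^sub>M j\<in>{1..n}. ?C j) (\<lambda>x. \<lambda>j\<in>{1..n}. ?Y j x)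
      = (\<Pi>\<^sub>M j\<in>{1..n}. distr ?Q (count_space UNIV) (?Y j))"
    using n by (subst (asm) prob_space.indep_vars_iff_distr_eq_PiM'[OF prob_space_measure_pmf]) auto
  also have "\<dots> = (\<Pi>\<^sub>M j\<in>{1..n}. distr M (count_space UNIV) (X j))"
    by (intro PiM_cong) (simp_all add: marg)
  also have "\<dots> = distr M (\<Pi>\<^sub>M j\<in>{1..n}. ?C j) (\<lambda>x. \<lambda>j\<in>{1..n}. X j x)"
    using n indep by (subst (asm) indep_vars_iff_distr_eq_PiM') (auto intro: rvX)
  finally have joint: "distr M (\<Pi>\<^sub>M j\<in>{1..n}. ?C j) (\<lambda>x. \<lambda>j\<in>{1..n}. X j x)
      = distr ?Q (\<Pi>\<^sub>M j\<in>{1..n}. ?C j) (\<lambda>x. \<lambda>j\<in>{1..n}. ?Y j x)" ..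
  have JX: "(\<lambda>x. \<lambda>j\<in>{1..n}. X j x) \<in> measurable M (\<Pi>\<^sub>M j\<in>{1..n}. ?C j)"
    by (intro measurable_restrict rvX)
  have JY: "(\<lambda>x. \<lambda>j\<in>{1..n}. ?Y j x) \<in> measurable ?Q (\<Pi>\<^sub>M j\<in>{1..n}. ?C j)"
    by (intro measurable_restrict) simp
  have SX: "(\<lambda>x. \<Sum>j=1..n. X j x) \<in> measurable M (count_space UNIV)"
    using measurable_compose[OF JX S] by simp
  have "distr M (count_space UNIV) (\<lambda>x. \<Sum>j=1..n. X j x)
      = distr ?Q (count_space UNIV) (\<lambda>x. \<Sum>j=1..n. ?Y j x)"
    using arg_cong[OF joint, of "\<lambda>N. distr N (count_space UNIV) ?S"]
    by (simp add: distr_distr[OF S JX] distr_distr[OF S JY] o_def del: One_nat_def sum_of_bool_eq)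
  also have "\<dots> = measure_pmf (bernoulli_sum_pmf n p)"
    by (simp add: bernoulli_sum_pmf_def map_pmf_rep_eq)
  finally have "measure (distr M (count_space UNIV) (\<lambda>x. \<Sum>j=1..n. X j x)) {k}
      = pmf (bernoulli_sum_pmf n p) k"
    by (simp add: measure_pmf_single)
  then show ?thesis
    by (subst (asm) measure_distr[OF SX]) (auto simp: vimage_def Int_def conj_commute)
qed

end

theory Submission
  imports Defs "HOL-Complex_Analysis.Complex_Analysis"
begin

text \<open>
  The inequality \<open>D \<le> \<chi>\<^sup>2\<close> is \<open>ln x \<le> x - 1\<close>, applied term by term. For the second inequality
  write the generating function of \<open>W\<close> as \<open>exp (\<lambda> (z - 1)) F (z - 1)\<close> with
  \<open>F u = (\<Prod>j. (1 + p\<^sub>j u) exp (- p\<^sub>j u)) = (\<Sum>k. b\<^sub>k u\<^sup>k)\<close>. Comparing coefficients gives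
  \<open>w\<^sub>x / v\<^sub>x = (\<Sum>k. b\<^sub>k C\<^sub>k x)\<close> with the Charlier polynomials \<open>C\<^sub>k\<close>, which are orthogonal for the
  Poisson law with squared norms \<open>k! / \<lambda>\<^sup>k\<close>. Since \<open>b\<^sub>0 = 1\<close> and \<open>b\<^sub>1 = 0\<close>, the \<open>\<chi>\<^sup>2\<close>-distance is at
  most the sum of \<open>b\<^sub>k\<^sup>2 k! / \<lambda>\<^sup>k\<close> over \<open>k \<ge> 2\<close>; passing to the limit in the partial sums of the
  expansion gives this inequality without completeness of the Charlier polynomials.
  From \<open>\<bar>1 + p u\<bar>\<^sup>2 \<le> exp (2 p Re u + p\<^sup>2 \<bar>u\<bar>\<^sup>2)\<close> one gets
  \<open>\<bar>F u\<bar> \<le> exp (\<lambda>\<^sub>2 \<bar>u\<bar>\<^sup>2 / 2)\<close>, and Cauchy's inequality on the circle \<open>\<bar>u\<bar>\<^sup>2 = k / \<lambda>\<^sub>2\<close> bounds the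
  \<open>k\<close>-th summand by \<open>e k (\<lambda>\<^sub>2 / \<lambda>)\<^sup>k\<close>.
\<close>

section \<open>Series of probabilities and the comparison of the two distances\<close>

lemma sum_le_sums:
  fixes f :: "nat \<Rightarrow> real"
  assumes "f sums s" "\<And>n. 0 \<le> f n"
  shows "(\<Sum>n<N. f n) \<le> s"
  using sum_le_suminf[of f "{..<N}"] assms by (simp add: sums_iff)

lemma pmf_nat_sums: "pmf (W :: nat pmf) sums 1"
proof -
  note W = pmf_abs_summable[of W UNIV]
  have "summable (pmf W)"
    using W by (simp add: abs_summable_on_nat_iff')
  moreover have "(\<Sum>k. pmf W k) = 1"
    using infsetsum_nat'[OF W] infsetsum_pmf_eq_1[of W UNIV] by simp
  ultimately show ?thesis
    by (simp add: sums_iff)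
qed

lemma relative_entropy_le_chi2_dist:
  assumes W: "finite (set_pmf W)" and Z: "\<And>k. pmf Z k > 0"
  shows "relative_entropy W Z \<le> chi2_dist W Z"
proof -
  \<comment> \<open>With w and v the two probabilities, w (w/v - 1) equals (w - v)^2 / v plus the
    correction w - v. The correction may have either sign, but sums to 1 - 1 = 0 over all k.\<close>
  have le: "pmf W k * ln (pmf W k / pmf Z k) \<le>
      (pmf W k - pmf Z k)\<^sup>2 / pmf Z k + (pmf W k - pmf Z k)" for k
  proof -
    have "pmf W k * ln (pmf W k / pmf Z k) \<le> pmf W k * (pmf W k / pmf Z k - 1)"
    proof (cases "pmf W k = 0")
      case False
      then have "pmf W k / pmf Z k > 0"
        using Z[of k] pmf_nonneg[of W k] by (simp add: less_le)
      from ln_le_minus_one[OF this] show ?thesis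
        by (intro mult_left_mono) auto
    qed simp
    also have "\<dots> = (pmf W k - pmf Z k)\<^sup>2 / pmf Z k + (pmf W k - pmf Z k)"
      using Z[of k] by (simp add: field_simps power2_eq_square)
    finally show ?thesis .
  qed
  have "(\<lambda>k. (pmf W k - pmf Z k)\<^sup>2 / pmf Z k + (pmf W k - pmf Z k)) sums (chi2_dist W Z + (1 - 1))"
    unfolding chi2_dist_def
    by (intro sums_add sums_diff pmf_nat_sums summable_sums summable_chi2_dist W)
  then have "(\<lambda>k. (pmf W k - pmf Z k)\<^sup>2 / pmf Z k + (pmf W k - pmf Z k)) sums chi2_dist W Z"
    by simp
  then show ?thesis
    unfolding relative_entropy_def
    by (rule sums_le[OF le summable_sums[OF summable_relative_entropy[OF W]]])
qed

section \<open>Charlier polynomials: orthogonality and a Bessel inequality\<close>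

text \<open>These are the classical Charlier polynomials times (-1)^k. After multiplication by the
  Poisson weight, the recursion is the coefficient form of multiplying a generating function by z -
  1. At x = 0 the truncated \<open>x - 1\<close> is harmless, because its term carries the factor
  \<open>x\<close>.\<close>

primrec charlier :: "real \<Rightarrow> nat \<Rightarrow> nat \<Rightarrow> real" where
  "charlier a 0 x = 1"
| "charlier a (Suc k) x = x / a * charlier a k (x - 1) - charlier a k x"

text \<open>The forward difference lowers the degree by one, as differentiation does for powers.
  Applying the recursion at x + 1 and at x reduces the claim to the previous degree. This is the
  lowering half of the orthogonality proof.\<close>

lemma charlier_diff:
  assumes "a > 0"
  shows "charlier a (Suc k) (Suc x) - charlier a (Suc k) x = Suc k / a * charlier a k x"
proof (induction k arbitrary: x)
  case 0
  then show ?case using assms by (simp add: field_simps)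
next
  case (Suc k)
  have 1: "charlier a (Suc k) (Suc x) = charlier a (Suc k) x + Suc k / a * charlier a k x"
    using Suc[of x] by (simp del: charlier.simps)
  \<comment> \<open>The factor \<open>x\<close> keeps the identity true at x = 0, where
    \<open>x - 1\<close> is again 0.\<close>
  have 2: "real x * charlier a (Suc k) x =
      real x * (charlier a (Suc k) (x - 1) + Suc k / a * charlier a k (x - 1))"
    using Suc[of "x - 1"] by (cases x) (simp_all del: charlier.simps add: algebra_simps)
  have "charlier a (Suc (Suc k)) (Suc x) - charlier a (Suc (Suc k)) x =
      1 / a * charlier a (Suc k) x + (real x * charlier a (Suc k) x) / a
      - x / a * charlier a (Suc k) (x - 1)
      - (charlier a (Suc k) (Suc x) - charlier a (Suc k) x)"
    using assms by (subst (1 2) charlier.simps(2)) (simp del: charlier.simps add: field_simps)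
  also have "\<dots> = 1 / a * charlier a (Suc k) x
      + Suc k / a * (x / a * charlier a k (x - 1) - charlier a k x)"
    unfolding 1 2 using assms by (simp del: charlier.simps add: field_simps)
  also have "\<dots> = Suc (Suc k) / a * charlier a (Suc k) x"
    using assms by (simp add: field_simps)
  finally show ?case .
qed

lemma abs_charlier_le:
  assumes "a > 0"
  shows "\<bar>charlier a k x\<bar> \<le> (1 + x / a) ^ k"
proof (induction k arbitrary: x)
  case (Suc k)
  have "(1 + (real (x - 1)) / a) ^ k \<le> (1 + x / a) ^ k"
    using assms by (intro power_mono add_left_mono divide_right_mono) auto
  then have "\<bar>x / a * charlier a k (x - 1)\<bar> \<le> x / a * (1 + x / a) ^ k"
    using assms Suc[of "x - 1"] by (auto simp: abs_mult intro!: divide_right_mono mult_left_mono)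
  then have "\<bar>x / a * charlier a k (x - 1)\<bar> + \<bar>charlier a k x\<bar> \<le> (1 + x / a) ^ Suc k"
    using Suc[of x] by (simp add: algebra_simps)
  then show ?case
    unfolding charlier.simps by (rule order_trans[OF abs_triangle_ineq4])
qed simp

lemma power_div_fact_le_exp:
  assumes "(x :: real) \<ge> 0"
  shows "x ^ n / fact n \<le> exp x"
proof -
  have "(\<Sum>k\<in>{n}. x ^ k /\<^sub>R fact k) \<le> exp x"
    unfolding exp_def using assms by (intro sum_le_suminf summable_exp_generic) auto
  then show ?thesis
    by (simp add: divide_inverse mult.commute)
qed

text \<open>The polynomial growth from \<open>abs_charlier_le\<close> is absorbed into an
  exponential by y^n \<le> n! exp y with y = 1 + x/a. Against the Poisson weight this leaves a
  multiple of the exponential series at \<open>a * exp (1 / a)\<close>.\<close>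

lemma summable_poisson_charlier:
  assumes "a > 0"
  shows "summable (\<lambda>x. pmf (poisson_pmf a) x * charlier a k x * charlier a m x)"
proof (rule summable_comparison_test')
  show "summable (\<lambda>x. fact (k + m) * exp (1 - a) * (inverse (fact x) * (a * exp (1 / a)) ^ x))"
    by (intro summable_mult summable_exp)
  fix x :: nat
  have "norm (charlier a k x * charlier a m x) \<le> (1 + x / a) ^ (k + m)"
    unfolding abs_mult power_add real_norm_def using assms
    by (intro mult_mono abs_charlier_le) auto
  also have "\<dots> \<le> fact (k + m) * exp (1 + x / a)"
    using power_div_fact_le_exp[of "1 + x / a" "k + m"] assms by (simp add: field_simps)
  finally have "norm (pmf (poisson_pmf a) x * charlier a k x * charlier a m x)
      \<le> pmf (poisson_pmf a) x * (fact (k + m) * exp (1 + x / a))"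
    unfolding mult.assoc norm_mult[of "pmf _ _"] by (intro mult_mono) auto
  also have "exp (1 + x / a) = exp 1 * exp (1 / a) ^ x"
    by (simp add: exp_add flip: exp_of_nat_mult)
  also have "pmf (poisson_pmf a) x * (fact (k + m) * (exp 1 * exp (1 / a) ^ x)) =
      fact (k + m) * exp (1 - a) * (inverse (fact x) * (a * exp (1 / a)) ^ x)"
    using assms by (simp add: exp_diff exp_minus power_mult_distrib divide_simps)
  finally show "norm (pmf (poisson_pmf a) x * charlier a k x * charlier a m x)
      \<le> fact (k + m) * exp (1 - a) * (inverse (fact x) * (a * exp (1 / a)) ^ x)" .
qed

lemma pmf_poisson_Suc:
  "a > 0 \<Longrightarrow> real (Suc x) / a * pmf (poisson_pmf a) (Suc x) = pmf (poisson_pmf a) x"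
  by (simp del: of_nat_Suc)

text \<open>Raising the degree is adjoint to the forward difference of \<open>g\<close> under the
  Poisson law: (x + 1)/a times the weight at x + 1 is the weight at x, so the first term of the
  recursion becomes a shift of \<open>g\<close>.\<close>

lemma poisson_charlier_summation_by_parts:
  assumes "a > 0"
    and 1: "(\<lambda>x. pmf (poisson_pmf a) x * charlier a k x * g (Suc x)) sums s"
    and 2: "(\<lambda>x. pmf (poisson_pmf a) x * charlier a k x * g x) sums t"
  shows "(\<lambda>x. pmf (poisson_pmf a) x * charlier a (Suc k) x * g x) sums (s - t)"
proof -
  let ?h = "\<lambda>x. real x / a * pmf (poisson_pmf a) x * charlier a k (x - 1) * g x"
  have "?h (Suc x) = pmf (poisson_pmf a) x * charlier a k x * g (Suc x)" for x
    using pmf_poisson_Suc[OF assms(1)] by (simp only: diff_Suc_1)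
  then have "(\<lambda>x. ?h (Suc x)) sums s"
    using 1 by (simp only:)
  \<comment> \<open>The series may start at 0 instead of 1, since \<open>?h 0\<close> vanishes
    through its factor \<open>x\<close>.\<close>
  then have "?h sums s"
    by (subst (asm) sums_Suc_iff) simp
  from sums_diff[OF this 2] show ?thesis
    by (simp add: algebra_simps del: pmf_poisson)
qed

text \<open>Summation by parts moves one degree off the first polynomial and turns the second into
  its difference, a multiple of the polynomial of degree m - 1. Both degrees thus drop by one,
  whence the induction on \<open>k\<close> with \<open>m\<close> arbitrary.\<close>

lemma charlier_orthogonal:
  assumes "a > 0"
  shows "(\<lambda>x. pmf (poisson_pmf a) x * charlier a k x * charlier a m x)
    sums (if k = m then fact k / a ^ k else 0)"
proof (induction k arbitrary: m)
  \<comment> \<open>Summation by parts with \<open>g\<close> constant 1, whose difference is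
    zero.\<close>
  have zero: "(\<lambda>x. pmf (poisson_pmf a) x * charlier a (Suc k) x) sums 0" for k
  proof -
    have "summable (\<lambda>x. pmf (poisson_pmf a) x * charlier a k x * 1)"
      using summable_poisson_charlier[OF assms, of k 0] by simp
    then obtain t where t: "(\<lambda>x. pmf (poisson_pmf a) x * charlier a k x * 1) sums t"
      by (auto simp only: summable_def)
    from poisson_charlier_summation_by_parts[OF assms this this] show ?thesis
      by (simp only: mult_1_right diff_self)
  qed
  {
    case 0
    show ?case
    proof (cases m)
      case 0
      then show ?thesis using pmf_nat_sums[of "poisson_pmf a"] by (simp del: pmf_poisson)
    next
      case (Suc m')
      then show ?thesis using zero[of m'] by (simp del: charlier.simps(2) pmf_poisson)
    qed
  next
    case (Suc k)
    show ?case
    proof (cases m)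
      case 0
      then show ?thesis using zero[of k] by (simp del: charlier.simps(2) pmf_poisson)
    next
      case m: (Suc m')
      let ?v = "pmf (poisson_pmf a)"
      \<comment> \<open>The value of \<open>t\<close> is irrelevant: it cancels in the difference
        formed by the summation by parts.\<close>
      obtain t where t: "(\<lambda>x. ?v x * charlier a k x * charlier a m x) sums t"
        using summable_poisson_charlier[OF assms] by (auto simp only: summable_def)
      have "(\<lambda>x. ?v x * charlier a k x * charlier a m x
          + m / a * (?v x * charlier a k x * charlier a m' x))
          sums (t + m / a * (if k = m' then fact k / a ^ k else 0))"
        by (intro sums_add t sums_mult Suc)
      also have "(\<lambda>x. ?v x * charlier a k x * charlier a m x
          + m / a * (?v x * charlier a k x * charlier a m' x)) =
          (\<lambda>x. ?v x * charlier a k x * charlier a m (Suc x))"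
      proof
        fix x
        have eq: "charlier a m (Suc x) = charlier a m x + m / a * charlier a m' x"
          using charlier_diff[OF assms, of m' x] m by (simp del: charlier.simps)
        show "?v x * charlier a k x * charlier a m x
          + m / a * (?v x * charlier a k x * charlier a m' x) =
          ?v x * charlier a k x * charlier a m (Suc x)"
          unfolding eq by (simp only: distrib_left mult_ac)
      qed
      finally have "(\<lambda>x. ?v x * charlier a (Suc k) x * charlier a m x)
          sums (m / a * (if k = m' then fact k / a ^ k else 0))"
        using poisson_charlier_summation_by_parts[OF assms _ t]
        by (subst add_diff_cancel_left'[of t, symmetric])
      moreover have "m / a * (if k = m' then fact k / a ^ k else 0) =
          (if Suc k = m then fact (Suc k) / a ^ Suc k else 0)"
        using m by (cases "k = m'") simp_all
      ultimately show ?thesis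
        by (simp only:)
    qed
  }
qed

text \<open>A Fatou argument: orthogonality evaluates the weighted square sum of each partial
  expansion exactly. Restricting to finitely many x, pointwise convergence allows K to tend to
  infinity; afterwards the range of x is enlarged.\<close>

lemma charlier_Bessel_sum:
  assumes a: "a > 0" and g: "\<And>x. (\<lambda>k. c k * charlier a k x) sums g x"
    and S: "(\<lambda>k. (c k)\<^sup>2 * fact k / a ^ k) sums S"
  shows "(\<Sum>x. pmf (poisson_pmf a) x * (g x)\<^sup>2) \<le> S"
proof -
  let ?v = "pmf (poisson_pmf a)"
  have part: "(\<lambda>x. ?v x * (\<Sum>k<K. c k * charlier a k x)\<^sup>2) sums (\<Sum>k<K. (c k)\<^sup>2 * fact k / a ^ k)" for K
  proof -
    have "(\<lambda>x. \<Sum>k<K. \<Sum>m<K. c k * c m * (?v x * charlier a k x * charlier a m x))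
      sums (\<Sum>k<K. \<Sum>m<K. c k * c m * (if k = m then fact k / a ^ k else 0))"
      by (intro sums_sum sums_mult charlier_orthogonal a)
    also have "(\<lambda>x. \<Sum>k<K. \<Sum>m<K. c k * c m * (?v x * charlier a k x * charlier a m x)) =
        (\<lambda>x. ?v x * (\<Sum>k<K. c k * charlier a k x)\<^sup>2)"
      by (simp add: power2_eq_square sum_product sum_distrib_left mult_ac del: pmf_poisson)
    also have "(\<Sum>k<K. \<Sum>m<K. c k * c m * (if k = m then fact k / a ^ k else 0)) =
        (\<Sum>k<K. (c k)\<^sup>2 * fact k / a ^ k)"
      by (simp add: if_distrib[of "\<lambda>y. _ * y"] power2_eq_square mult.assoc cong: if_cong)
    finally show ?thesis .
  qed
  have "(\<Sum>x<N. ?v x * (g x)\<^sup>2) \<le> S" for N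
  proof (rule LIMSEQ_le_const2)
    show "(\<lambda>K. \<Sum>x<N. ?v x * (\<Sum>k<K. c k * charlier a k x)\<^sup>2) \<longlonglongrightarrow> (\<Sum>x<N. ?v x * (g x)\<^sup>2)"
      using g unfolding sums_def by (intro tendsto_intros) auto
    have "(\<Sum>x<N. ?v x * (\<Sum>k<K. c k * charlier a k x)\<^sup>2) \<le> S" for K
    proof -
      have "(\<Sum>x<N. ?v x * (\<Sum>k<K. c k * charlier a k x)\<^sup>2) \<le> (\<Sum>k<K. (c k)\<^sup>2 * fact k / a ^ k)"
        by (rule sum_le_sums[OF part]) (simp del: pmf_poisson)
      also have "\<dots> \<le> S"
        using a by (intro sum_le_sums[OF S]) simp_all
      finally show ?thesis .
    qed
    then show "\<exists>M. \<forall>K\<ge>M. (\<Sum>x<N. ?v x * (\<Sum>k<K. c k * charlier a k x)\<^sup>2) \<le> S"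
      by blast
  qed
  moreover from this have "summable (\<lambda>x. ?v x * (g x)\<^sup>2)"
    by (intro summableI_nonneg_bounded[of _ S]) (simp_all del: pmf_poisson)
  ultimately show ?thesis
    by (intro suminf_le_const)
qed

section \<open>The ratio of generating functions and its Taylor coefficients\<close>

text \<open>This is \<open>F\<close> from the opening comment; the argument stands for the
  generating function variable minus 1.\<close>

definition pgf_ratio :: "'a set \<Rightarrow> ('a \<Rightarrow> real) \<Rightarrow> complex \<Rightarrow> complex" where
  "pgf_ratio A p z = (\<Prod>j\<in>A. (1 + of_real (p j) * z) * exp (- of_real (p j) * z))"

definition pgf_ratio_fps :: "'a set \<Rightarrow> ('a \<Rightarrow> real) \<Rightarrow> complex fps" where
  "pgf_ratio_fps A p =
    (\<Prod>j\<in>A. (1 + fps_const (of_real (p j)) * fps_X) * fps_exp (- of_real (p j)))"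

lemma has_fps_expansion_pgf_ratio: "pgf_ratio A p has_fps_expansion pgf_ratio_fps A p"
  unfolding pgf_ratio_def[abs_def] pgf_ratio_fps_def by (intro fps_expansion_intros)

lemma holomorphic_pgf_ratio [holomorphic_intros]: "pgf_ratio A p holomorphic_on S"
  unfolding pgf_ratio_def[abs_def] by (intro holomorphic_intros)

lemma norm_one_plus_times_exp_le:
  fixes z :: complex and p :: real
  shows "norm ((1 + of_real p * z) * exp (- of_real p * z)) \<le> exp (p\<^sup>2 * (norm z)\<^sup>2 / 2)"
proof -
  have "(norm (1 + of_real p * z))\<^sup>2 = 1 + (2 * p * Re z + p\<^sup>2 * (norm z)\<^sup>2)"
    unfolding cmod_power2 by (simp add: power2_eq_square algebra_simps)
  also have "\<dots> \<le> exp (2 * p * Re z + p\<^sup>2 * (norm z)\<^sup>2)"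
    by (rule exp_ge_add_one_self)
  also have "\<dots> = (exp (p * Re z + p\<^sup>2 * (norm z)\<^sup>2 / 2))\<^sup>2"
    by (simp flip: exp_double)
  finally have "norm (1 + of_real p * z) \<le> exp (p * Re z + p\<^sup>2 * (norm z)\<^sup>2 / 2)"
    by (rule power2_le_imp_le) simp
  \<comment> \<open>The compensating exponential has modulus \<open>exp (- p * Re z)\<close> and
    cancels exactly the linear part of the exponent.\<close>
  then have "norm (1 + of_real p * z) * exp (- p * Re z) \<le>
      exp (p * Re z + p\<^sup>2 * (norm z)\<^sup>2 / 2) * exp (- p * Re z)"
    by (intro mult_right_mono) auto
  then show ?thesis
    by (simp add: norm_mult flip: exp_add)
qed

lemma norm_pgf_ratio_le: "norm (pgf_ratio A p z) \<le> exp ((\<Sum>j\<in>A. (p j)\<^sup>2) * (norm z)\<^sup>2 / 2)"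
proof (cases "finite A")
  case True
  have "norm (pgf_ratio A p z) \<le> (\<Prod>j\<in>A. exp ((p j)\<^sup>2 * (norm z)\<^sup>2 / 2))"
    unfolding pgf_ratio_def prod_norm[symmetric]
    by (intro prod_mono conjI norm_one_plus_times_exp_le norm_ge_zero)
  also have "\<dots> = exp ((\<Sum>j\<in>A. (p j)\<^sup>2) * (norm z)\<^sup>2 / 2)"
    using True by (simp add: exp_sum sum_distrib_right sum_divide_distrib)
  finally show ?thesis .
qed (simp add: pgf_ratio_def)

text \<open>Cauchy's inequality with the radius left free: it is used once with the optimal radius
  for each \<open>k\<close> and once with a fixed radius to get uniform convergence.\<close>

lemma norm_pgf_ratio_fps_nth_le:
  assumes "r > 0"
  shows "norm (fps_nth (pgf_ratio_fps A p) k) \<le> exp ((\<Sum>j\<in>A. (p j)\<^sup>2) * r\<^sup>2 / 2) / r ^ k"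
proof -
  have "norm ((deriv ^^ k) (pgf_ratio A p) 0) \<le> fact k * exp ((\<Sum>j\<in>A. (p j)\<^sup>2) * r\<^sup>2 / 2) / r ^ k"
    using norm_pgf_ratio_le[of A p] assms
    by (intro Cauchy_inequality holomorphic_on_imp_continuous_on holomorphic_pgf_ratio)
      (metis diff_0 norm_minus_cancel)+
  then show ?thesis
    by (simp add: fps_nth_fps_expansion[OF has_fps_expansion_pgf_ratio] norm_divide field_simps)
qed

lemma pgf_ratio_sums: "(\<lambda>k. fps_nth (pgf_ratio_fps A p) k * z ^ k) sums pgf_ratio A p z"
  using holomorphic_power_series[OF holomorphic_pgf_ratio, of z 0 "norm z + 1" A p]
  by (simp add: fps_nth_fps_expansion[OF has_fps_expansion_pgf_ratio])

lemma pgf_ratio_fps_nth_0: "fps_nth (pgf_ratio_fps A p) 0 = 1"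
  using has_fps_expansion_imp_0_eq_fps_nth_0[OF has_fps_expansion_pgf_ratio, of A p]
  by (simp add: pgf_ratio_def)

text \<open>Each factor has constant coefficient 1 and linear coefficient p - p = 0, and products
  inherit this. It reflects that the Bernoulli sum and the Poisson law have equal means.\<close>

lemma pgf_ratio_fps_nth_1: "fps_nth (pgf_ratio_fps A p) (Suc 0) = 0"
proof (induction A rule: infinite_finite_induct)
  case (insert j A)
  have "pgf_ratio_fps (insert j A) p =
      ((1 + fps_const (of_real (p j)) * fps_X) * fps_exp (- of_real (p j))) * pgf_ratio_fps A p"
    using insert by (simp add: pgf_ratio_fps_def)
  then show ?case
    using insert pgf_ratio_fps_nth_0[of A p] by (simp add: fps_mult_nth)
qed (simp_all add: pgf_ratio_fps_def)

text \<open>An upper Stirling bound k! \<le> e k (k/e)^k. The induction step amounts to e \<le> (1 +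
  1/k)^(k+1), which follows from ln y \<le> y - 1 at y = k/(k+1).\<close>

lemma fact_le_Stirling:
  assumes "k > 0"
  shows "fact k * exp k \<le> exp 1 * k * real k ^ k"
  using assms
proof (induction k rule: nat_induct_non_zero)
  case (Suc k)
  have "exp (1 :: real) \<le> (1 + 1 / k) ^ Suc k"
  proof -
    have "1 - k / (1 + k) \<le> ln (1 / (k / (1 + real k)))"
      using ln_le_minus_one[of "k / (1 + real k)"] Suc.hyps by (subst ln_div) auto
    then have "1 / (1 + k) \<le> ln (1 + 1 / k)"
      using Suc.hyps by (simp add: field_simps)
    then have "1 \<le> Suc k * ln (1 + 1 / k)"
      by (simp add: field_simps)
    then have "exp 1 \<le> exp (Suc k * ln (1 + 1 / k))"
      by (simp only: exp_le_cancel_iff)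
    also have "\<dots> = (1 + 1 / k) ^ Suc k"
      using Suc.hyps by (subst exp_of_nat_mult) (simp add: add_pos_nonneg)
    finally show ?thesis .
  qed
  then have "Suc k * (fact k * exp k) * exp 1 \<le> Suc k * (exp 1 * k * real k ^ k) * (1 + 1 / k) ^ Suc k"
    using Suc.IH by (intro mult_mono mult_left_mono[OF Suc.IH]) auto
  also have "\<dots> = exp 1 * Suc k * (k * (1 + 1 / k)) ^ Suc k"
    by (simp add: power_mult_distrib)
  also have "k * (1 + 1 / k) = Suc k"
    using Suc.hyps by (simp add: field_simps)
  finally show ?case
    by (simp add: exp_add mult_ac)
qed simp

lemma norm_pgf_ratio_fps_nth_power2_le:
  assumes "(\<Sum>j\<in>A. (p j)\<^sup>2) > 0" "k > 0"
  shows "(norm (fps_nth (pgf_ratio_fps A p) k))\<^sup>2 * fact k \<le> exp 1 * k * (\<Sum>j\<in>A. (p j)\<^sup>2) ^ k"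
proof -
  define s where "s = (\<Sum>j\<in>A. (p j)\<^sup>2)"
  \<comment> \<open>This radius minimises \<open>exp (s * r\<^sup>2) / (r\<^sup>2) ^ k\<close>, the
    square of the Cauchy bound.\<close>
  define r where "r = sqrt (k / s)"
  have s: "s > 0" and r: "r > 0" "r\<^sup>2 = k / s"
    using assms by (simp_all add: r_def s_def)
  have "(norm (fps_nth (pgf_ratio_fps A p) k))\<^sup>2 \<le> (exp (s * r\<^sup>2 / 2) / r ^ k)\<^sup>2"
    unfolding s_def by (intro power_mono norm_pgf_ratio_fps_nth_le r) simp
  also have "\<dots> = exp (s * r\<^sup>2) / (r\<^sup>2) ^ k"
    by (simp add: power_divide power_mult[symmetric] mult.commute flip: exp_double)
  also have "\<dots> = exp k * s ^ k / real k ^ k"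
    using s r(2) by (simp add: power_divide)
  finally have "(norm (fps_nth (pgf_ratio_fps A p) k))\<^sup>2 * fact k \<le>
      exp k * s ^ k / real k ^ k * fact k"
    by (rule mult_right_mono) simp
  also have "\<dots> = (fact k * exp k) * s ^ k / real k ^ k"
    by simp
  also have "\<dots> \<le> (exp 1 * k * real k ^ k) * s ^ k / real k ^ k"
    using s by (intro divide_right_mono mult_right_mono fact_le_Stirling assms) auto
  also have "\<dots> = exp 1 * k * s ^ k"
    using assms by simp
  finally show ?thesis
    by (simp add: s_def)
qed

section \<open>Generating functions and the Charlier expansion of the density\<close>

lemma bernoulli_sum_pmf_Suc:
  "bernoulli_sum_pmf (Suc n) p =
    bernoulli_pmf (p (Suc n)) \<bind> (\<lambda>b. map_pmf ((+) (of_bool b)) (bernoulli_sum_pmf n p))"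
proof -
  have "(\<Sum>j=1..n. of_bool (if j = Suc n then b else f j)) = (\<Sum>j=1..n. of_bool (f j) :: nat)" for b f
    by (intro sum.cong) auto
  then show ?thesis
    unfolding bernoulli_sum_pmf_def
    by (simp add: atLeastAtMostSuc_conv Pi_pmf_insert' map_bind_pmf map_pmf_comp
        map_pmf_def[symmetric] bind_return_pmf fun_upd_def o_def del: sum_of_bool_eq)
qed

lemma pmf_bernoulli_sum_pmf_Suc:
  assumes "0 \<le> p (Suc n)" "p (Suc n) \<le> 1"
  shows "pmf (bernoulli_sum_pmf (Suc n) p) x = (1 - p (Suc n)) * pmf (bernoulli_sum_pmf n p) x
    + p (Suc n) * (if x = 0 then 0 else pmf (bernoulli_sum_pmf n p) (x - 1))"
proof -
  have 1: "pmf (map_pmf Suc (bernoulli_sum_pmf n p)) x =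
      (if x = 0 then 0 else pmf (bernoulli_sum_pmf n p) (x - 1))"
    using pmf_map_inj'[of Suc "bernoulli_sum_pmf n p"] by (cases x) (auto simp: pmf_eq_0_set_pmf)
  have 2: "(+) 0 = (\<lambda>x::nat. x)" and 3: "(+) (Suc 0) = Suc"
    by auto
  show ?thesis
    unfolding bernoulli_sum_pmf_Suc pmf_bind using assms by (simp add: 1 2 3)
qed

lemma bernoulli_sum_pmf_fps:
  assumes "\<And>j. j \<in> {1..n} \<Longrightarrow> 0 \<le> p j \<and> p j \<le> 1"
  shows "Abs_fps (\<lambda>x. of_real (pmf (bernoulli_sum_pmf n p) x)) =
    (\<Prod>j=1..n. fps_const (of_real (1 - p j)) + fps_const (of_real (p j)) * fps_X :: complex fps)"
  using assms
proof (induction n)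
  case 0
  then show ?case
    by (auto simp: fps_eq_iff bernoulli_sum_pmf_def)
next
  case (Suc n)
  have "Abs_fps (\<lambda>x. of_real (pmf (bernoulli_sum_pmf (Suc n) p) x)) =
      (fps_const (of_real (1 - p (Suc n))) + fps_const (of_real (p (Suc n))) * fps_X) *
      Abs_fps (\<lambda>x. complex_of_real (pmf (bernoulli_sum_pmf n p) x))"
    using Suc.prems[of "Suc n"]
    by (auto simp: fps_eq_iff pmf_bernoulli_sum_pmf_Suc distrib_right mult.assoc)
  then show ?case
    using Suc by (simp add: mult.commute)
qed

text \<open>The exponential of the total parameter splits over j and cancels the compensating
  factors, leaving the product of the Bernoulli generating functions 1 + p (z - 1).\<close>

lemma has_fps_expansion_bernoulli_sum_pmf:
  assumes "\<And>j. j \<in> {1..n} \<Longrightarrow> 0 \<le> p j \<and> p j \<le> 1"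
  shows "(\<lambda>z. exp (of_real (\<Sum>j=1..n. p j) * (z - 1)) * pgf_ratio {1..n} p (z - 1))
    has_fps_expansion Abs_fps (\<lambda>x. of_real (pmf (bernoulli_sum_pmf n p) x))"
proof -
  have "exp (of_real (\<Sum>j=1..n. p j) * (z - 1)) * pgf_ratio {1..n} p (z - 1) =
      (\<Prod>j=1..n. of_real (1 - p j) + of_real (p j) * z)" for z
  proof -
    have "exp (of_real (\<Sum>j=1..n. p j) * (z - 1)) = (\<Prod>j=1..n. exp (of_real (p j) * (z - 1)))"
      by (simp add: exp_sum sum_distrib_right)
    then have "exp (of_real (\<Sum>j=1..n. p j) * (z - 1)) * pgf_ratio {1..n} p (z - 1) =
        (\<Prod>j=1..n. exp (of_real (p j) * (z - 1)) *
          ((1 + of_real (p j) * (z - 1)) * exp (- of_real (p j) * (z - 1))))"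
      by (simp only: pgf_ratio_def prod.distrib)
    also have "\<dots> = (\<Prod>j=1..n. of_real (1 - p j) + of_real (p j) * z)"
      by (intro prod.cong) (simp_all add: exp_minus divide_simps, simp_all add: algebra_simps)
    finally show ?thesis .
  qed
  moreover have "(\<lambda>z. \<Prod>j=1..n. of_real (1 - p j) + of_real (p j) * z) has_fps_expansion
      (\<Prod>j=1..n. fps_const (of_real (1 - p j)) + fps_const (of_real (p j)) * fps_X :: complex fps)"
    by (intro fps_expansion_intros)
  ultimately show ?thesis
    by (simp only: bernoulli_sum_pmf_fps[OF assms])
qed

text \<open>Start from the Poisson generating function; each further factor z - 1 acts on
  coefficients as the Charlier recursion does on the weighted polynomials.\<close>

lemma has_fps_expansion_poisson_charlier:
  assumes "a > 0"
  shows "(\<lambda>z. exp (of_real a * (z - 1)) * (z - 1) ^ k) has_fps_expansion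
    Abs_fps (\<lambda>x. complex_of_real (pmf (poisson_pmf a) x * charlier a k x))"
proof (induction k)
  case 0
  have "(\<lambda>z. exp (- of_real a) * exp (of_real a * z)) has_fps_expansion
      fps_const (exp (- of_real a)) * fps_exp (complex_of_real a)"
    by (intro fps_expansion_intros)
  also have "(\<lambda>z. exp (- of_real a) * exp (of_real a * z)) = (\<lambda>z. exp (complex_of_real a * (z - 1)))"
    by (simp add: algebra_simps flip: exp_add)
  also have "fps_const (exp (- of_real a)) * fps_exp (complex_of_real a) =
      Abs_fps (\<lambda>x. complex_of_real (pmf (poisson_pmf a) x))"
    using assms by (simp add: fps_eq_iff exp_of_real flip: of_real_minus)
  finally show ?case by simp
next
  case (Suc k)
  have "(\<lambda>z. (z - 1) * (exp (of_real a * (z - 1)) * (z - 1) ^ k)) has_fps_expansion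
    (fps_X - 1) * Abs_fps (\<lambda>x. complex_of_real (pmf (poisson_pmf a) x * charlier a k x))"
    by (intro fps_expansion_intros Suc)
  also have "(\<lambda>z. (z - 1) * (exp (of_real a * (z - 1)) * (z - 1) ^ k)) =
      (\<lambda>z. exp (complex_of_real a * (z - 1)) * (z - 1) ^ Suc k)"
    by (simp add: mult_ac)
  also have "(fps_X - 1) * Abs_fps (\<lambda>x. complex_of_real (pmf (poisson_pmf a) x * charlier a k x)) =
      Abs_fps (\<lambda>x. complex_of_real (pmf (poisson_pmf a) x * charlier a (Suc k) x))"
  proof (rule fps_ext)
    fix x
    show "((fps_X - 1) * Abs_fps (\<lambda>x. complex_of_real (pmf (poisson_pmf a) x * charlier a k x))) $ x =
      Abs_fps (\<lambda>x. complex_of_real (pmf (poisson_pmf a) x * charlier a (Suc k) x)) $ x"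
    proof (cases x)
      case (Suc y)
      have "real x / a * pmf (poisson_pmf a) x = pmf (poisson_pmf a) y"
        unfolding Suc by (rule pmf_poisson_Suc[OF assms])
      then have "pmf (poisson_pmf a) x * charlier a (Suc k) x =
          pmf (poisson_pmf a) y * charlier a k y - pmf (poisson_pmf a) x * charlier a k x"
        using Suc by (simp add: right_diff_distrib mult_ac del: pmf_poisson of_nat_Suc)
          (metis mult.assoc mult.commute times_divide_eq_left)
      from this[folded of_real_eq_iff[where 'a = complex]] show ?thesis
        using Suc by (simp add: left_diff_distrib del: pmf_poisson charlier.simps)
    qed (simp add: left_diff_distrib)
  qed
  finally show ?case .
qed

text \<open>Cauchy's inequality for the difference \<open>f n - g\<close> on the circle of radius
  \<open>r\<close> controls its coefficients by its supremum there.\<close>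

lemma uniform_limit_imp_fps_nth_tendsto:
  fixes f :: "nat \<Rightarrow> complex \<Rightarrow> complex"
  assumes lim: "uniform_limit (cball 0 r) f g sequentially" and r: "r > 0"
    and f: "\<And>n. f n holomorphic_on UNIV" "\<And>n. f n has_fps_expansion F n"
    and g: "g holomorphic_on UNIV" "g has_fps_expansion G"
  shows "(\<lambda>n. fps_nth (F n) x) \<longlonglongrightarrow> fps_nth G x"
proof (rule tendstoI)
  fix e :: real assume e: "e > 0"
  have "\<forall>\<^sub>F n in sequentially. \<forall>z\<in>cball 0 r. dist (f n z) (g z) < e / 2 * r ^ x"
    using lim e r by (intro uniform_limitD) auto
  then show "\<forall>\<^sub>F n in sequentially. dist (fps_nth (F n) x) (fps_nth G x) < e"
  proof eventually_elim
    case (elim n)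
    have "norm ((deriv ^^ x) (\<lambda>z. f n z - g z) 0) \<le> fact x * (e / 2 * r ^ x) / r ^ x"
    proof (rule Cauchy_inequality)
      show "continuous_on (cball 0 r) (\<lambda>z. f n z - g z)"
        using f g by (intro holomorphic_on_imp_continuous_on holomorphic_intros)
          (blast intro: holomorphic_on_subset)+
      show "(\<lambda>z. f n z - g z) holomorphic_on ball 0 r"
        using f g by (intro holomorphic_intros) (blast intro: holomorphic_on_subset)+
      show "norm (f n z - g z) \<le> e / 2 * r ^ x" if "norm (0 - z) = r" for z
        using elim[rule_format, of z] that by (simp add: dist_norm)
    qed (use r in simp)
    moreover have "fps_nth (F n - G) x = (deriv ^^ x) (\<lambda>z. f n z - g z) 0 / fact x"
      using f g by (intro fps_nth_fps_expansion fps_expansion_intros)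
    ultimately have "norm (fps_nth (F n - G) x) \<le> e / 2"
      using r by (simp add: norm_divide divide_le_eq mult.commute)
    then show ?case
      using e by (simp add: dist_norm)
  qed
qed

text \<open>The power series of the ratio at z - 1, times the Poisson exponential, is a series of
  entire functions converging uniformly on the unit disc. Hence coefficients of z^x may be compared
  termwise, and dividing by the Poisson weight gives the claim. Taking real parts is compatible with
  this, as the other factors are real.\<close>

lemma bernoulli_sum_charlier_expansion:
  assumes p: "\<And>j. j \<in> {1..n} \<Longrightarrow> 0 \<le> p j \<and> p j \<le> 1" and a: "a = (\<Sum>j=1..n. p j)" "a > 0"
  shows "(\<lambda>k. Re (fps_nth (pgf_ratio_fps {1..n} p) k) * charlier a k x) sums
    (pmf (bernoulli_sum_pmf n p) x / pmf (poisson_pmf a) x)"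
proof -
  let ?b = "fps_nth (pgf_ratio_fps {1..n} p)"
  let ?f = "\<lambda>k z. ?b k * (exp (of_real a * (z - 1)) * (z - 1) ^ k)"
  let ?g = "\<lambda>z. exp (of_real a * (z - 1)) * pgf_ratio {1..n} p (z - 1)"
  \<comment> \<open>The Cauchy bound is taken at radius 4. On the unit disc |z - 1| \<le> 2, so the
    k-th term is at most a constant times (2/4)^k.\<close>
  let ?C = "exp ((\<Sum>j=1..n. (p j)\<^sup>2) * 4\<^sup>2 / 2)"
  have sums: "(\<lambda>k. ?f k z) sums ?g z" for z
    using sums_mult[OF pgf_ratio_sums[of "{1..n}" p "z - 1"], of "exp (of_real a * (z - 1))"]
    by (simp add: mult_ac)
  have "uniform_limit (cball 0 1) (\<lambda>K z. \<Sum>k<K. ?f k z) (\<lambda>z. \<Sum>k. ?f k z) sequentially"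
  proof (rule Weierstrass_m_test)
    show "summable (\<lambda>k. ?C * (1 / 2) ^ k)"
      by (intro summable_mult summable_geometric) simp
    fix k and z :: complex assume z: "z \<in> cball 0 1"
    have "Re z \<le> 1"
      using z complex_Re_le_cmod[of z] by simp
    then have "norm (exp (of_real a * (z - 1))) \<le> 1"
      using a by (simp add: mult_nonneg_nonpos)
    moreover have "norm (z - 1) ^ k \<le> 2 ^ k"
      using z norm_triangle_ineq4[of z 1] by (intro power_mono) auto
    ultimately have "norm (?f k z) \<le> ?C / 4 ^ k * (1 * 2 ^ k)"
      unfolding norm_mult norm_power
      by (intro mult_mono norm_pgf_ratio_fps_nth_le) auto
    also have "\<dots> = ?C * (1 / 2) ^ k"
      using power_mult_distrib[of "2::real" 2 k] by (simp add: power_divide)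
    finally show "norm (?f k z) \<le> ?C * (1 / 2) ^ k" .
  qed
  also have "(\<lambda>z. \<Sum>k. ?f k z) = ?g"
    using sums by (simp add: sums_iff)
  finally have "(\<lambda>K. fps_nth (\<Sum>k<K. fps_const (?b k) *
      Abs_fps (\<lambda>x. complex_of_real (pmf (poisson_pmf a) x * charlier a k x))) x)
      \<longlonglongrightarrow> fps_nth (Abs_fps (\<lambda>x. of_real (pmf (bernoulli_sum_pmf n p) x))) x"
  proof (rule uniform_limit_imp_fps_nth_tendsto)
    show "?g has_fps_expansion Abs_fps (\<lambda>x. of_real (pmf (bernoulli_sum_pmf n p) x))"
      unfolding a(1) by (intro has_fps_expansion_bernoulli_sum_pmf p)
    show "?g holomorphic_on UNIV"
      using holomorphic_on_compose[OF _ holomorphic_pgf_ratio, of "\<lambda>z. z - 1" UNIV "{1..n}" p]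
      by (intro holomorphic_intros) (simp_all add: o_def holomorphic_intros)
  qed (intro fps_expansion_intros has_fps_expansion_poisson_charlier a holomorphic_intros | simp)+
  then have "(\<lambda>k. ?b k * complex_of_real (pmf (poisson_pmf a) x * charlier a k x))
      sums of_real (pmf (bernoulli_sum_pmf n p) x)"
    by (simp add: sums_def fps_sum_nth del: pmf_poisson)
  from sums_divide[OF sums_Re[OF this], of "pmf (poisson_pmf a) x"] show ?thesis
    using a by simp
qed

section \<open>The bound on the chi-square distance\<close>

lemma chi2_dist_bernoulli_sum_poisson_le:
  assumes p: "\<And>j. j \<in> {1..n} \<Longrightarrow> 0 \<le> p j \<and> p j \<le> 1"
    and a: "a = (\<Sum>j=1..n. p j)" "a > 0"
    and s: "s = (\<Sum>j=1..n. (p j)\<^sup>2)" "s \<le> a / 2"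
  shows "chi2_dist (bernoulli_sum_pmf n p) (poisson_pmf a) \<le> 16 * exp 1 * (s / a)\<^sup>2"
proof -
  let ?w = "pmf (bernoulli_sum_pmf n p)" and ?v = "pmf (poisson_pmf a)"
  let ?b = "fps_nth (pgf_ratio_fps {1..n} p)"
  \<comment> \<open>Deleting the coefficient of index 0, which is 1, subtracts the constant 1 from
    the density ratio.\<close>
  define c where "c k = (if k = 0 then 0 else Re (?b k))" for k
  have spos: "s > 0"
  proof -
    obtain j where "j \<in> {1..n}" "p j \<noteq> 0"
      using a by (metis less_irrefl sum.neutral)
    then show ?thesis
      unfolding s(1) by (intro sum_pos2[of _ j]) auto
  qed
  have expansion: "(\<lambda>k. c k * charlier a k x) sums (?w x / ?v x - 1)" for x
  proof -
    have "(\<lambda>k. Re (?b k) * charlier a k x - (if k = 0 then 1 else 0)) sums (?w x / ?v x - 1)"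
      by (intro sums_diff bernoulli_sum_charlier_expansion sums_single p a)
    also have "(\<lambda>k. Re (?b k) * charlier a k x - (if k = 0 then 1 else 0)) =
        (\<lambda>k. c k * charlier a k x)"
      by (auto simp: c_def pgf_ratio_fps_nth_0)
    finally show ?thesis .
  qed
  \<comment> \<open>For k \<ge> 2 two factors \<open>s / a\<close> are kept and the other k - 2 are
    bounded by 1/2; rewriting (1/2)^(k-2) costs the 4. Relaxing \<open>k\<close> to
    \<open>Suc k\<close> fits the differentiated geometric series.\<close>
  have bound: "(c k)\<^sup>2 * fact k / a ^ k \<le> 4 * exp 1 * (s / a)\<^sup>2 * (of_nat (Suc k) * (1 / 2) ^ k)" for k
  proof (cases "k < 2")
    case True
    then have "c k = 0"
      by (auto simp: c_def less_2_cases_iff pgf_ratio_fps_nth_1)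
    then show ?thesis by simp
  next
    case False
    then obtain m where k: "k = m + 2"
      by (metis add.commute le_Suc_ex not_less)
    have "(c k)\<^sup>2 \<le> (norm (?b k))\<^sup>2"
      using abs_Re_le_cmod[of "?b k"] by (simp add: c_def abs_le_square_iff[symmetric])
    then have "(c k)\<^sup>2 * fact k / a ^ k \<le> (norm (?b k))\<^sup>2 * fact k / a ^ k"
      using a by (intro divide_right_mono mult_right_mono) auto
    also have "\<dots> \<le> exp 1 * k * s ^ k / a ^ k"
      using a spos k norm_pgf_ratio_fps_nth_power2_le[of p "{1..n}" k] unfolding s(1)
      by (intro divide_right_mono) auto
    also have "\<dots> = exp 1 * (s / a)\<^sup>2 * (k * (s / a) ^ m)"
      by (simp add: k power_add power_divide power2_eq_square mult_ac)
    also have "\<dots> \<le> exp 1 * (s / a)\<^sup>2 * (Suc k * (1 / 2) ^ m)"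
      using a s spos by (intro mult_left_mono mult_mono power_mono) (auto simp: field_simps)
    also have "\<dots> = 4 * exp 1 * (s / a)\<^sup>2 * (of_nat (Suc k) * (1 / 2) ^ k)"
      by (simp add: k power_add)
    finally show ?thesis .
  qed
  \<comment> \<open>The sum of (k + 1) / 2^k is 1 / (1 - 1/2)^2 = 4, whence the constant 16
    e.\<close>
  have geometric: "(\<lambda>k. 4 * exp 1 * (s / a)\<^sup>2 * (of_nat (Suc k) * (1 / 2) ^ k)) sums
      (16 * exp 1 * (s / a)\<^sup>2)"
    using sums_mult[OF geometric_deriv_sums[of "1 / 2 :: real"], of "4 * exp 1 * (s / a)\<^sup>2"]
    by (simp add: power2_eq_square mult_ac)
  have "summable (\<lambda>k. (c k)\<^sup>2 * fact k / a ^ k)"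
    using bound a by (intro summable_comparison_test'[OF sums_summable[OF geometric], of 0]) simp
  then obtain S where S: "(\<lambda>k. (c k)\<^sup>2 * fact k / a ^ k) sums S"
    by (auto simp only: summable_def)
  have "?v x * (?w x / ?v x - 1)\<^sup>2 = (?w x - ?v x)\<^sup>2 / ?v x" for x
  proof -
    have "?v x > 0"
      using a by simp
    then show ?thesis
      by (simp add: field_simps power2_eq_square del: pmf_poisson)
  qed
  then have "chi2_dist (bernoulli_sum_pmf n p) (poisson_pmf a) =
      (\<Sum>x. ?v x * (?w x / ?v x - 1)\<^sup>2)"
    by (simp add: chi2_dist_def del: pmf_poisson)
  also have "\<dots> \<le> S"
    by (rule charlier_Bessel_sum[OF a(2) expansion S])
  also have "S \<le> 16 * exp 1 * (s / a)\<^sup>2"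
    by (rule sums_le[OF bound S geometric])
  finally show ?thesis .
qed

theorem theorem1p2:
  shows "\<exists>c::real. c > 0 \<and>
    (\<forall>(n::nat) (p::nat \<Rightarrow> real) (lam::real) (lam2::real) (W::nat pmf) (Z::nat pmf).
       n \<ge> 1 \<longrightarrow>
       (\<forall>j\<in>{1..n}. 0 \<le> p j \<and> p j \<le> 1) \<longrightarrow>
       lam = (\<Sum>j=1..n. p j) \<longrightarrow>
       lam > 0 \<longrightarrow>
       lam2 = (\<Sum>j=1..n. (p j)\<^sup>2) \<longrightarrow>
       W = bernoulli_sum_pmf n p \<longrightarrow>
       Z = poisson_pmf lam \<longrightarrow>
       lam2 \<le> lam / 2 \<longrightarrow>
       relative_entropy W Z \<le> chi2_dist W Z \<and>
       chi2_dist W Z \<le> c * (lam2 / lam)\<^sup>2)"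
proof (intro exI[of _ "16 * exp 1"] conjI allI impI)
  fix n p and lam lam2 :: real and W Z
  assume asm: "n \<ge> 1" "\<forall>j\<in>{1..n}. 0 \<le> p j \<and> p j \<le> 1" "lam = (\<Sum>j=1..n. p j)" "lam > 0"
    "lam2 = (\<Sum>j=1..n. (p j)\<^sup>2)" "W = bernoulli_sum_pmf n p" "Z = poisson_pmf lam" "lam2 \<le> lam / 2"
  have "finite (set_pmf W)"
    unfolding asm(6) using set_pmf_bernoulli_sum by (rule finite_subset) simp
  then show "relative_entropy W Z \<le> chi2_dist W Z"
    unfolding asm(7) by (rule relative_entropy_le_chi2_dist) (simp add: asm(4))
  show "chi2_dist W Z \<le> 16 * exp 1 * (lam2 / lam)\<^sup>2"
    using asm by (auto intro!: chi2_dist_bernoulli_sum_poisson_le)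
qed simp

end
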